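(* Let $n\in\mathbb{N}$. Then \[ \mathsf{g}_{\pm}(C_n)=\begin{cases} n+1 & \text{if } n\equiv 2 \pmod 4,\\ n & \text{otherwise}.\end{cases} \]
   Context: For a finite abelian group $G$ (written additively), $\exp(G)$ denotes its exponent and $C_m$ a cyclic group of order $m$. The plus-minus weighted Harborth constant $\mathsf{g}_{\pm}(G)$ is the smallest $\ell\in\mathbb{N}$ such that for every subset $S\subseteq G$ with $|S|\ge\ell$ there exist $\exp(G)$ distinct elements $g_1,\dots,g_{\exp(G)}\in S$ and signs $\varepsilon_1,\dots,\varepsilon_{\exp(G)}\in\{+1,-1\}$ with $\sum_i \varepsilon_i g_i=0$. (If no subset of $G$ has cardinality $\ell$, the condition is vacuously satisfied.) *)

theory Defs
  imports "HOL-Algebra.Algebra"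
begin

text \<open>
  Groups are HOL-Algebra groups and therefore written multiplicatively: for an abelian group, the
  weighted sum of elements \<open>g i\<close> with signs \<open>\<epsilon> i\<close> is the product of the powers \<open>g i [^] \<epsilon> i\<close>, and
  the neutral element \<open>\<one>\<close> plays the role of \<open>0\<close>.
\<close>

definition group_exponent :: "('a, 'b) monoid_scheme \<Rightarrow> nat" where
  "group_exponent G = (LEAST m. m > 0 \<and> (\<forall>x\<in>carrier G. x [^]\<^bsub>G\<^esub> m = \<one>\<^bsub>G\<^esub>))"

definition has_pm_zero_sum :: "('a, 'b) monoid_scheme \<Rightarrow> nat \<Rightarrow> 'a set \<Rightarrow> bool" where
  "has_pm_zero_sum G m S \<longleftrightarrow>
     (\<exists>(g :: nat \<Rightarrow> 'a) (\<epsilon> :: nat \<Rightarrow> int).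
        inj_on g {1..m} \<and> g ` {1..m} \<subseteq> S \<and> \<epsilon> ` {1..m} \<subseteq> {1, -1} \<and>
        (\<Otimes>\<^bsub>G\<^esub>i\<in>{1..m}. g i [^]\<^bsub>G\<^esub> \<epsilon> i) = \<one>\<^bsub>G\<^esub>)"

text \<open>
  Meaningful for finite abelian groups; there the minimum is over a nonempty set, since
  every \<open>l > order G\<close> satisfies the condition vacuously.
\<close>

definition pm_harborth :: "('a, 'b) monoid_scheme \<Rightarrow> nat" where
  "pm_harborth G =
     (LEAST l. \<forall>S. S \<subseteq> carrier G \<and> card S \<ge> l \<longrightarrow> has_pm_zero_sum G (group_exponent G) S)"

end

theory Submission
  imports Defs
begin

text \<open>
  A cyclic group of order \<open>n\<close> has exponent \<open>n\<close>, so only \<open>S = G\<close> can contain \<open>n\<close> distinct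
  elements, and the question is whether \<open>\<plusminus>1 \<plusminus> 2 \<plusminus> \<dots> \<plusminus> n\<close> can be divisible by \<open>n\<close>. For odd \<open>n\<close> all
  signs may be positive. For \<open>4 | n\<close> the plain sum is \<open>n / 2\<close> modulo \<open>n\<close>, which is cancelled by
  flipping the sign of \<open>n / 4\<close>. For \<open>n \<equiv> 2 (mod 4)\<close> every signed sum is odd while \<open>n\<close> is even.
\<close>

lemma (in comm_group) finprod_int_pow:
  assumes "x \<in> carrier G"
  shows "(\<Otimes>i\<in>A. x [^] (f i :: int)) = x [^] sum f A"
proof (induction A rule: infinite_finite_induct)
  case (insert a A)
  then show ?case
    using assms by (simp add: int_pow_mult)
qed (simp_all add: assms)

text \<open>The order annihilates every element by Lagrange; conversely, an exponent that kills the
  generator \<open>x\<close> is a multiple of \<open>ord x\<close>.\<close>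

lemma (in group) group_exponent_cyclic:
  assumes "x \<in> carrier G" "ord x = order G" "order G > 0"
  shows "group_exponent G = order G"
  unfolding group_exponent_def
proof (rule Least_equality)
  show "0 < order G \<and> (\<forall>y\<in>carrier G. y [^] order G = \<one>)"
    using assms(3) pow_order_eq_1 by blast
next
  fix m :: nat assume "0 < m \<and> (\<forall>y\<in>carrier G. y [^] m = \<one>)"
  then show "order G \<le> m"
    using assms pow_eq_id dvd_imp_le by metis
qed

text \<open>Exponents start at 1, not 0, to match the index set of \<open>has_pm_zero_sum\<close>.
  Injectivity on \<open>ord x\<close> exponents gives surjectivity by counting.\<close>

lemma (in group) bij_betw_pow_generator:
  assumes "x \<in> carrier G" "ord x = order G" "order G > 0"
  shows "bij_betw (\<lambda>k::nat. x [^] k) {1..order G} (carrier G)"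
proof -
  have inj: "inj_on (\<lambda>k::nat. x [^] k) {1..order G}"
    using ord_inj'[OF assms(1)] assms(2) by simp
  have fin: "finite (carrier G)"
    using assms(3) by (simp add: order_gt_0_iff_finite)
  have "(\<lambda>k::nat. x [^] k) ` {1..order G} = carrier G"
    by (rule card_subset_eq[OF fin]) (use assms(1) card_image[OF inj] in \<open>auto simp: order_def\<close>)
  with inj show ?thesis
    by (simp add: bij_betw_def)
qed

lemma exists_signed_sum_dvd:
  assumes "n mod 4 \<noteq> 2"
  obtains \<epsilon> :: "nat \<Rightarrow> int"
  where "\<epsilon> ` {1..n} \<subseteq> {1, -1}" "int n dvd (\<Sum>i\<in>{1..n}. int i * \<epsilon> i)"
proof (cases "even n")
  case False
  have "2 * (\<Sum>i\<in>{1..n}. int i) = int n * (int n + 1)"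
    using double_gauss_sum_from_Suc_0[of n, where ?'a = int] by simp
  then have "int n dvd 2 * (\<Sum>i\<in>{1..n}. int i)"
    by simp
  moreover have "coprime (int n) 2"
    using False by simp
  ultimately have "int n dvd (\<Sum>i\<in>{1..n}. int i)"
    using coprime_dvd_mult_right_iff by blast
  then show ?thesis
    by (intro that[of "\<lambda>_. 1"]) auto
next
  case True
  with assms have "n mod 4 = 0"
    by presburger
  then obtain k where k: "n = 4 * k"
    by (metis mod_0_imp_dvd dvdE)
  define \<epsilon> :: "nat \<Rightarrow> int" where "\<epsilon> i = (if i = k then -1 else 1)" for i
  have "2 * (\<Sum>i\<in>{1..n}. int i) = int n * (int n + 1)"
    using double_gauss_sum_from_Suc_0[of n, where ?'a = int] by simp
  then have total: "(\<Sum>i\<in>{1..n}. int i) = 2 * int k * (4 * int k + 1)"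
    unfolding k by simp
  have "(\<Sum>i\<in>{1..n}. int i * \<epsilon> i) = (\<Sum>i\<in>{1..n}. int i - (if i = k then 2 * int k else 0))"
    by (rule sum.cong) (auto simp: \<epsilon>_def)
  \<comment> \<open>If \<open>k = 0\<close>, the flipped index lies outside the empty range, but the
    correction \<open>2 * int k\<close> vanishes as well.\<close>
  also have "\<dots> = 2 * int k * (4 * int k + 1) - 2 * int k"
    unfolding sum_subtractf total by (auto simp: k)
  also have "\<dots> = int n * (2 * int k)"
    by (simp add: k algebra_simps)
  finally have "int n dvd (\<Sum>i\<in>{1..n}. int i * \<epsilon> i)"
    by simp
  then show ?thesis
    by (intro that[of \<epsilon>]) (auto simp: \<epsilon>_def)
qed

text \<open>Each sign changes its term by 0 or by \<open>-2 * a i\<close>, both even.\<close>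

lemma signed_sum_parity:
  fixes a \<epsilon> :: "'a \<Rightarrow> int"
  assumes "\<epsilon> ` A \<subseteq> {1, -1}"
  shows "even (\<Sum>i\<in>A. a i * \<epsilon> i) \<longleftrightarrow> even (\<Sum>i\<in>A. a i)"
proof -
  have "even (\<Sum>i\<in>A. a i * \<epsilon> i - a i)"
    using assms by (intro dvd_sum) force
  then show ?thesis
    by (simp add: sum_subtractf)
qed

lemma (in comm_group) has_pm_zero_sum_carrier_iff:
  assumes x: "x \<in> carrier G" "ord x = order G" and pos: "order G > 0"
  shows "has_pm_zero_sum G (order G) (carrier G) \<longleftrightarrow> order G mod 4 \<noteq> 2"
proof
  let ?n = "order G" and ?p = "\<lambda>k::nat. x [^] k"
  have bij: "bij_betw ?p {1..?n} (carrier G)"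
    using bij_betw_pow_generator assms .
  \<comment> \<open>Taking discrete logarithms to base \<open>x\<close> moves the problem to
    integers modulo the order. The exponents \<open>a\<close> stay general: the construction takes
    the identity, the converse a permutation.\<close>
  have prod_eq: "(\<Otimes>i\<in>A. ?p (a i) [^] \<epsilon> i) = \<one> \<longleftrightarrow> int ?n dvd (\<Sum>i\<in>A. int (a i) * \<epsilon> i)"
    for A :: "nat set" and a and \<epsilon> :: "nat \<Rightarrow> int"
  proof -
    have "?p (a i) [^] \<epsilon> i = x [^] (int (a i) * \<epsilon> i)" for i
      using x(1) by (metis int_pow_int int_pow_pow)
    then show ?thesis
      using x by (simp add: finprod_int_pow int_pow_eq_id)
  qed
  {
    assume "order G mod 4 \<noteq> 2"
    then obtain \<epsilon> :: "nat \<Rightarrow> int" where "\<epsilon> ` {1..?n} \<subseteq> {1, -1}"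
      and "int ?n dvd (\<Sum>i\<in>{1..?n}. int i * \<epsilon> i)"
      by (rule exists_signed_sum_dvd)
    moreover from this have "(\<Otimes>i\<in>{1..?n}. ?p i [^] \<epsilon> i) = \<one>"
      using prod_eq[of "\<lambda>i. i"] by simp
    ultimately show "has_pm_zero_sum G ?n (carrier G)"
      using bij unfolding has_pm_zero_sum_def bij_betw_def by blast
  }
  assume "has_pm_zero_sum G ?n (carrier G)"
  then obtain g and \<epsilon> :: "nat \<Rightarrow> int" where g: "inj_on g {1..?n}" "g ` {1..?n} \<subseteq> carrier G"
    and \<epsilon>: "\<epsilon> ` {1..?n} \<subseteq> {1, -1}" and zero: "(\<Otimes>i\<in>{1..?n}. g i [^] \<epsilon> i) = \<one>"
    unfolding has_pm_zero_sum_def by blast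
  have "finite (carrier G)"
    using pos by (simp add: order_gt_0_iff_finite)
  then have "g ` {1..?n} = carrier G"
    by (rule card_subset_eq) (use g card_image[OF g(1)] in \<open>auto simp: order_def\<close>)
  with g(1) have "bij_betw g {1..?n} (carrier G)"
    by (simp add: bij_betw_def)
  \<comment> \<open>Since \<open>g\<close> enumerates the whole group, its discrete logarithms
    permute \<open>{1..?n}\<close>, so their unsigned sum is the Gauss sum.\<close>
  then have bij_a: "bij_betw (the_inv_into {1..?n} ?p \<circ> g) {1..?n} {1..?n}"
    using bij_betw_trans bij_betw_the_inv_into[OF bij] by blast
  define a where "a = the_inv_into {1..?n} ?p \<circ> g"
  have "?p (a i) = g i" if "i \<in> {1..?n}" for i
  proof -
    have "g i \<in> carrier G"
      using that g(2) by blast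
    then show ?thesis
      using f_the_inv_into_f_bij_betw[OF bij, of "g i"] by (simp add: a_def)
  qed
  then have "(\<Otimes>i\<in>{1..?n}. ?p (a i) [^] \<epsilon> i) = (\<Otimes>i\<in>{1..?n}. g i [^] \<epsilon> i)"
    using g(2) by (intro finprod_cong') (auto intro: int_pow_closed)
  with zero have dvd: "int ?n dvd (\<Sum>i\<in>{1..?n}. int (a i) * \<epsilon> i)"
    using prod_eq by simp
  have "(\<Sum>i\<in>{1..?n}. int (a i)) = (\<Sum>i\<in>{1..?n}. int i)"
    using bij_a sum.reindex_bij_betw unfolding a_def by blast
  then have total: "2 * (\<Sum>i\<in>{1..?n}. int (a i)) = int ?n * (int ?n + 1)"
    using double_gauss_sum_from_Suc_0[of ?n, where ?'a = int] by simp
  show "?n mod 4 \<noteq> 2"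
  proof
    assume mod: "?n mod 4 = 2"
    define k where "k = ?n div 4"
    have k: "?n = 4 * k + 2"
      using mod div_mult_mod_eq[of ?n 4] by (simp add: k_def)
    \<comment> \<open>Halving this leaves a product of two odd factors, so the unsigned sum is
      odd.\<close>
    then have "int ?n * (int ?n + 1) = 2 * ((2 * int k + 1) * (4 * int k + 3))"
      by (simp add: algebra_simps)
    then have "(\<Sum>i\<in>{1..?n}. int (a i)) = (2 * int k + 1) * (4 * int k + 3)"
      using total by linarith
    then have "odd (\<Sum>i\<in>{1..?n}. int (a i))"
      by simp
    then have "odd (\<Sum>i\<in>{1..?n}. int (a i) * \<epsilon> i)"
      using signed_sum_parity[OF \<epsilon>] by blast
    moreover have "even (int ?n)"
      using k by simp
    ultimately show False
      using dvd dvd_trans by blast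
  qed
qed

text \<open>This yields the lower bound \<open>n\<close> for the constant. Finiteness matters
  because \<open>card\<close> is 0 on infinite sets.\<close>

lemma has_pm_zero_sum_imp_card_ge:
  assumes "has_pm_zero_sum G m S" "finite S"
  shows "m \<le> card S"
proof -
  obtain g :: "nat \<Rightarrow> 'a" where "inj_on g {1..m}" "g ` {1..m} \<subseteq> S"
    using assms(1) unfolding has_pm_zero_sum_def by blast
  then show ?thesis
    using card_inj_on_le[of g "{1..m}" S] assms(2) by simp
qed

theorem theorem1p2:
  fixes G :: "('a, 'b) monoid_scheme" and n :: nat
  assumes "n \<ge> 1"
    and "group G" and "cyclic_group G" and "order G = n"
  shows "pm_harborth G = (if n mod 4 = 2 then n + 1 else n)"
proof -
  interpret comm_group G
    using group.cyclic_imp_abelian_group assms by blast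
  obtain x where x: "x \<in> carrier G" "subgroup_generated G {x} = G"
    using assms(3) unfolding cyclic_group_def by blast
  then have ord: "ord x = order G"
    using cyclic_order_is_ord by simp
  have pos: "order G > 0"
    using assms by simp
  then have fin: "finite (carrier G)"
    by (simp add: order_gt_0_iff_finite)
  have exp: "group_exponent G = n"
    using group_exponent_cyclic[OF x(1) ord pos] assms(4) by simp
  have full: "has_pm_zero_sum G n (carrier G) \<longleftrightarrow> n mod 4 \<noteq> 2"
    using has_pm_zero_sum_carrier_iff[OF x(1) ord pos] assms(4) by simp
  have card: "card (carrier G) = n"
    using assms(4) by (simp add: order_def)
  define P where
    "P l \<longleftrightarrow> (\<forall>S. S \<subseteq> carrier G \<and> card S \<ge> l \<longrightarrow> has_pm_zero_sum G n S)" for l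
  have lower: "n \<le> l" if "P l" for l
  proof (rule ccontr)
    assume "\<not> n \<le> l"
    then obtain S where S: "S \<subseteq> carrier G" "card S = l"
      using obtain_subset_with_card_n[of l "carrier G"] card by auto
    with that have "has_pm_zero_sum G n S"
      unfolding P_def by blast
    then show False
      using has_pm_zero_sum_imp_card_ge S fin finite_subset \<open>\<not> n \<le> l\<close> by metis
  qed
  have card_le: "card S \<le> n" if "S \<subseteq> carrier G" for S
    using card_mono[OF fin that] card by simp
  \<comment> \<open>The only subset with at least \<open>n\<close> elements is the carrier
    itself.\<close>
  have P_n: "P n \<longleftrightarrow> n mod 4 \<noteq> 2"
  proof -
    have "S = carrier G" if "S \<subseteq> carrier G" "n \<le> card S" for S
      using that card card_le card_subset_eq[OF fin] by (metis le_antisym)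
    then show ?thesis
      unfolding P_def using full card by auto
  qed
  \<comment> \<open>Vacuous: no subset is this large.\<close>
  have "P (n + 1)"
    unfolding P_def using card_le by (metis not_less_eq_eq Suc_eq_plus1)
  have "(LEAST l. P l) = (if n mod 4 = 2 then n + 1 else n)"
  proof (rule Least_equality)
    show "P (if n mod 4 = 2 then n + 1 else n)"
      using P_n \<open>P (n + 1)\<close> by simp
  next
    fix l assume "P l"
    then show "(if n mod 4 = 2 then n + 1 else n) \<le> l"
      \<comment> \<open>If \<open>n mod 4 = 2\<close>, then \<open>P_n\<close> rules out
        \<open>l = n\<close>, which raises the bound from \<open>n\<close> to
        \<open>n + 1\<close>.\<close>
      using lower[of l] P_n by (cases "l = n") auto
  qed
  then show ?thesis
    unfolding pm_harborth_def exp P_def .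
qed

end
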